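(* Let $f(\boldsymbol\alpha)=l(A\boldsymbol\alpha)+\mathbf c^\top\boldsymbol\alpha$ with $A\in\mathbb{R}^{d\times n}$ having columns $\mathbf A_1,\dots,\mathbf A_n\in\mathbb{R}^d$, $\mathbf c\in\mathbb{R}^n$ and $l:\mathbb{R}^d\to\mathbb{R}$ convex and differentiable, and let $\lambda\geq 0$, $\beta>0$. For any iterate $\boldsymbol\alpha^{(t)}\in\mathbb{R}^n$, with the point set $\mathcal P$, the subset $\mathcal B_t\subseteq\mathcal P$, the query vector $\mathbf q_t$ and the vector $\mathbf s(\boldsymbol\alpha)$ defined in the context, $$\operatorname{S-MIPS}_{\mathcal P}(\mathbf q_t;\mathcal B_t)=\arg\max_{i\in[n]}\big|s(\boldsymbol\alpha^{(t)})_i\big|,$$ where a vector $\pm\tilde{\mathbf A}_j^{\pm}\in\mathcal B_t$ returned by the left-hand side is identified with its coordinate index $j$.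
   Context: Vectors in $\mathbb{R}^{d+2}$: $\tilde{\mathbf A}_j^{+}=(\beta,\ \beta c_j,\ \mathbf A_j)^\top$ and $\tilde{\mathbf A}_j^{-}=(-\beta,\ \beta c_j,\ \mathbf A_j)^\top$ for $j\in[n]$; $\mathcal P=\{\pm\tilde{\mathbf A}_j^{+},\pm\tilde{\mathbf A}_j^{-}:j\in[n]\}$. Query: $\mathbf q_t=\big(\tfrac{\lambda}{\beta},\ \tfrac1\beta,\ \nabla l(A\boldsymbol\alpha^{(t)})\big)^\top$. Subset: $\mathcal B_t=\mathcal B_t^1\cup\mathcal B_t^2\cup\mathcal B_t^3\cup\mathcal B_t^4$ with $\mathcal B_t^1=\{\tilde{\mathbf A}_j^+:\alpha_j^{(t)}>0\}$, $\mathcal B_t^2=\{-\tilde{\mathbf A}_j^+:\alpha_j^{(t)}\ge0\}$, $\mathcal B_t^3=\{\tilde{\mathbf A}_j^-:\alpha_j^{(t)}\le0\}$, $\mathcal B_t^4=\{-\tilde{\mathbf A}_j^-:\alpha_j^{(t)}<0\}$. Subset maximum inner product search: $\operatorname{S-MIPS}_{\mathcal P}(\mathbf q;\mathcal B)=\arg\max_{\mathbf p\in\mathcal B}\langle\mathbf p,\mathbf q\rangle$. Here $\arg\max$ denotes a maximizing element, with ties broken arbitrarily. The vector $\mathbf s(\boldsymbol\alpha)$: $s(\boldsymbol\alpha)_i=S_\lambda(\nabla_i f(\boldsymbol\alpha))$ if $\alpha_i=0$, and $s(\boldsymbol\alpha)_i=\nabla_i f(\boldsymbol\alpha)+\mathrm{sign}(\alpha_i)\lambda$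 otherwise, where $S_\lambda(x)=x-\mathrm{sign}(x)\lambda$ if $|x|\ge\lambda$ and $S_\lambda(x)=0$ otherwise. (The right-hand side is the GS-s coordinate for $\min_{\boldsymbol\alpha}f(\boldsymbol\alpha)+\lambda\|\boldsymbol\alpha\|_1$.) *)

theory Defs
  imports "HOL-Analysis.Analysis"
begin

definition gradient :: "('a::real_inner \<Rightarrow> real) \<Rightarrow> 'a \<Rightarrow> 'a" where
  "gradient f x = (THE D. GDERIV f x :> D)"

lemma gradient_eqI: "GDERIV f x :> D \<Longrightarrow> gradient f x = D"
  unfolding gradient_def
proof (rule the_equality)
  fix E assume "GDERIV f x :> D" "GDERIV f x :> E"
  then have "(\<lambda>h. h \<bullet> E) = (\<lambda>h. h \<bullet> D)"
    unfolding gderiv_def by (rule has_derivative_unique[rotated])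
  then show "E = D" by (metis vector_eq_ldot)
qed

lemma GDERIV_gradient:
  fixes f :: "'a::euclidean_space \<Rightarrow> real"
  assumes "f differentiable (at x)"
  shows "GDERIV f x :> gradient f x"
proof -
  from assms obtain f' where f': "(f has_derivative f') (at x)"
    unfolding differentiable_def by blast
  then interpret bounded_linear f' by (rule has_derivative_bounded_linear)
  have "f' h = h \<bullet> adjoint f' 1" for h
    using adjoint_works[OF linear_axioms, of h 1] by simp
  then have "f' = (\<lambda>h. h \<bullet> adjoint f' 1)" by blast
  with f' have "GDERIV f x :> adjoint f' 1" by (simp add: gderiv_def)
  with gradient_eqI show ?thesis by metis
qed

definition argmax_set :: "('a \<Rightarrow> 'b::ord) \<Rightarrow> 'a set \<Rightarrow> 'a set" where
  "argmax_set f S = {x. is_arg_max f (\<lambda>y. y \<in> S) x}"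

definition S_MIPS :: "'a::real_inner set \<Rightarrow> 'a \<Rightarrow> 'a set \<Rightarrow> 'a set" where
  "S_MIPS P q B = {p \<in> P. p \<in> argmax_set (\<lambda>p. p \<bullet> q) B}"

definition objective ::
  "(real^'d \<Rightarrow> real) \<Rightarrow> real^'n^'d \<Rightarrow> real^'n \<Rightarrow> real^'n \<Rightarrow> real" where
  "objective l A c \<alpha> = l (A *v \<alpha>) + c \<bullet> \<alpha>"

definition soft_threshold :: "real \<Rightarrow> real \<Rightarrow> real" where
  "soft_threshold lam x = (if \<bar>x\<bar> \<ge> lam then x - sgn x * lam else 0)"

definition s_vec :: "real \<Rightarrow> (real^'n \<Rightarrow> real) \<Rightarrow> real^'n \<Rightarrow> real^'n" where
  "s_vec lam f \<alpha> = (\<chi> i. if \<alpha> $ i = 0 then soft_threshold lam (gradient f \<alpha> $ i)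
                          else gradient f \<alpha> $ i + sgn (\<alpha> $ i) * lam)"

text \<open>The space \<open>\<real>\<^bsup>d+2\<^esup>\<close> is rendered as the inner product space
  \<open>real \<times> real \<times> real^'d\<close>, following the block structure of the vectors.\<close>

definition tilde_plus ::
  "real \<Rightarrow> real^'n^'d \<Rightarrow> real^'n \<Rightarrow> 'n \<Rightarrow> real \<times> real \<times> (real^'d)" where
  "tilde_plus \<beta> A c j = (\<beta>, \<beta> * c $ j, column j A)"

definition tilde_minus ::
  "real \<Rightarrow> real^'n^'d \<Rightarrow> real^'n \<Rightarrow> 'n \<Rightarrow> real \<times> real \<times> (real^'d)" where
  "tilde_minus \<beta> A c j = (- \<beta>, \<beta> * c $ j, column j A)"

definition points ::
  "real \<Rightarrow> real^'n^'d \<Rightarrow> real^'n \<Rightarrow> (real \<times> real \<times> (real^'d)) set" where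
  "points \<beta> A c =
     (\<Union>j. {tilde_plus \<beta> A c j, - tilde_plus \<beta> A c j, tilde_minus \<beta> A c j, - tilde_minus \<beta> A c j})"

definition query ::
  "real \<Rightarrow> real \<Rightarrow> (real^'d \<Rightarrow> real) \<Rightarrow> real^'n^'d \<Rightarrow> real^'n \<Rightarrow> real \<times> real \<times> (real^'d)" where
  "query lam \<beta> l A \<alpha> = (lam / \<beta>, 1 / \<beta>, gradient l (A *v \<alpha>))"

definition B_subset ::
  "real \<Rightarrow> real^'n^'d \<Rightarrow> real^'n \<Rightarrow> real^'n \<Rightarrow> (real \<times> real \<times> (real^'d)) set" where
  "B_subset \<beta> A c \<alpha> =
     {tilde_plus \<beta> A c j | j. \<alpha> $ j > 0} \<union> {- tilde_plus \<beta> A c j | j. \<alpha> $ j \<ge> 0} \<union>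
     {tilde_minus \<beta> A c j | j. \<alpha> $ j \<le> 0} \<union> {- tilde_minus \<beta> A c j | j. \<alpha> $ j < 0}"

lemma B_subset_points: "B_subset \<beta> A c \<alpha> \<subseteq> points \<beta> A c"
  unfolding B_subset_def points_def by auto

text \<open>\<open>has_index \<beta> A c \<alpha> p j\<close>: the point \<open>p\<close> is one of the vectors with index \<open>j\<close>
  that \<open>j\<close> contributes to \<open>B_subset \<beta> A c \<alpha>\<close>. The sign conditions on \<open>\<alpha> $ j\<close> are needed
  because distinct indices may give the same vector (e.g. repeated columns), in which case
  \<open>p\<close> may lie in the subset on account of one of these indices but not of another.\<close>

definition has_index ::
  "real \<Rightarrow> real^'n^'d \<Rightarrow> real^'n \<Rightarrow> real^'n \<Rightarrow> real \<times> real \<times> (real^'d) \<Rightarrow> 'n \<Rightarrow> bool" where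
  "has_index \<beta> A c \<alpha> p j \<longleftrightarrow>
     p = tilde_plus \<beta> A c j \<and> \<alpha> $ j > 0 \<or> p = - tilde_plus \<beta> A c j \<and> \<alpha> $ j \<ge> 0 \<or>
     p = tilde_minus \<beta> A c j \<and> \<alpha> $ j \<le> 0 \<or> p = - tilde_minus \<beta> A c j \<and> \<alpha> $ j < 0"

lemma mem_B_subset_iff: "p \<in> B_subset \<beta> A c \<alpha> \<longleftrightarrow> (\<exists>j. has_index \<beta> A c \<alpha> p j)"
  unfolding B_subset_def has_index_def by auto

definition returned_indices ::
  "real \<Rightarrow> real^'n^'d \<Rightarrow> real^'n \<Rightarrow> real^'n \<Rightarrow> (real \<times> real \<times> (real^'d)) set \<Rightarrow> 'n set" where
  "returned_indices \<beta> A c \<alpha> S = {j. \<exists>p\<in>S. has_index \<beta> A c \<alpha> p j}"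

text \<open>With ties broken arbitrarily, the set of returned indices consists of maximizers of
  \<open>\<bar>s_vec lam f \<alpha> $ i\<bar>\<close>, and it is the set of all of them unless \<open>s_vec lam f \<alpha> = 0\<close>. In that
  case every index is a maximizer, whereas the inner products still distinguish between indices with
  \<open>\<alpha> $ i = 0\<close> and different \<open>\<bar>gradient f \<alpha> $ i\<bar> \<le> lam\<close>.\<close>

end

theory Submission
  imports Defs
begin

text \<open>The inner products of the query with the vectors of index \<open>j\<close> are \<open>\<plusminus>(g\<^sub>j + \<lambda>)\<close> and
  \<open>\<plusminus>(g\<^sub>j - \<lambda>)\<close> for \<open>g = \<nabla>f(\<alpha>)\<close>. The subset keeps the two values whose maximum is
  \<open>\<bar>g\<^sub>j + sign(\<alpha>\<^sub>j) \<lambda>\<bar>\<close> if \<open>\<alpha>\<^sub>j \<noteq> 0\<close>, and \<open>-(g\<^sub>j + \<lambda>)\<close>, \<open>g\<^sub>j - \<lambda>\<close> with maximum \<open>\<bar>g\<^sub>j\<bar> - \<lambda>\<close>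
  if \<open>\<alpha>\<^sub>j = 0\<close>. In both cases \<open>\<bar>s\<^sub>j\<bar>\<close> is the positive part of this maximum, and taking
  positive parts preserves maximizers, and creates no new ones if the largest value is positive.\<close>

text \<open>By the chain rule the derivative at \<alpha> is
  \<open>h \<mapsto> (A *v h) \<bullet> ?g + c \<bullet> h\<close>; moving \<open>A\<close> across
  the inner product as its transpose exhibits the gradient.\<close>

lemma gradient_objective:
  fixes A :: "real^'n^'d"
  assumes "l differentiable (at (A *v \<alpha>))"
  shows "gradient (objective l A c) \<alpha> $ j = column j A \<bullet> gradient l (A *v \<alpha>) + c $ j"
proof -
  let ?g = "gradient l (A *v \<alpha>)"
  have "(l has_derivative (\<lambda>h. h \<bullet> ?g)) (at (A *v \<alpha>))"
    using GDERIV_gradient[OF assms] by (simp add: gderiv_def)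
  then have "((\<lambda>x. l (A *v x)) has_derivative (\<lambda>h. (A *v h) \<bullet> ?g)) (at \<alpha>)"
    by (rule has_derivative_compose[rotated])
      (simp add: bounded_linear_imp_has_derivative matrix_vector_mul_bounded_linear)
  then have "(objective l A c has_derivative (\<lambda>h. (A *v h) \<bullet> ?g + c \<bullet> h)) (at \<alpha>)"
    unfolding objective_def[abs_def] by (auto intro!: derivative_eq_intros)
  moreover have "(A *v h) \<bullet> ?g + c \<bullet> h = h \<bullet> (transpose A *v ?g + c)" for h
    using dot_lmul_matrix[of ?g A h]
    by (simp add: transpose_matrix_vector inner_add_right inner_commute)
  ultimately have "gradient (objective l A c) \<alpha> = transpose A *v ?g + c"
    by (intro gradient_eqI) (simp add: gderiv_def)
  then show ?thesis
    by (simp add: matrix_vector_mult_def transpose_def column_def inner_vec_def)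
qed

lemma argmax_set_linorder:
  fixes f :: "'a \<Rightarrow> 'b::linorder"
  shows "x \<in> argmax_set f S \<longleftrightarrow> x \<in> S \<and> (\<forall>y\<in>S. f y \<le> f x)"
  by (auto simp: argmax_set_def is_arg_max_linorder)

lemma argmax_set_finite_nonempty:
  fixes f :: "'a::finite \<Rightarrow> 'b::linorder"
  shows "argmax_set f UNIV \<noteq> {}"
proof -
  have "Max (range f) \<in> range f"
    by (rule Max_in) auto
  then obtain x where "f x = Max (range f)"
    by (metis imageE)
  then have "x \<in> argmax_set f UNIV"
    by (simp add: argmax_set_linorder)
  then show ?thesis by blast
qed

lemma argmax_set_max_const:
  fixes f :: "'a \<Rightarrow> 'b::linorder"
  shows "argmax_set f S \<subseteq> argmax_set (\<lambda>x. max b (f x)) S"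
    and "\<exists>x\<in>S. b < f x \<Longrightarrow> argmax_set (\<lambda>x. max b (f x)) S = argmax_set f S"
proof -
  show "argmax_set f S \<subseteq> argmax_set (\<lambda>x. max b (f x)) S"
    unfolding argmax_set_linorder subset_iff by (blast intro: max.mono)
next
  assume "\<exists>x\<in>S. b < f x"
  then obtain y where y: "y \<in> S" "b < f y" by blast
  have "f z \<le> f x" if "\<forall>z\<in>S. max b (f z) \<le> max b (f x)" "z \<in> S" for x z
  proof -
    \<comment> \<open>Comparison with \<open>y\<close>, whose value exceeds \<open>b\<close>, rules
      out that the maximum at \<open>x\<close> is \<open>b\<close> itself.\<close>
    have "b < f x"
      using that(1) y by (force simp: le_max_iff_disj)
    then show ?thesis
      using that by (force simp: le_max_iff_disj)
  qed
  then show "argmax_set (\<lambda>x. max b (f x)) S = argmax_set f S"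
    unfolding argmax_set_linorder set_eq_iff by (blast intro: max.mono)
qed

text \<open>With \<open>g\<close> the gradient of the objective, this is the largest inner product
  with the query among the vectors that \<open>j\<close> contributes. It can be negative when
  \<open>\<alpha> $ j = 0\<close>.\<close>

definition index_score :: "real \<Rightarrow> real^'n \<Rightarrow> real^'n \<Rightarrow> 'n \<Rightarrow> real" where
  "index_score lam g \<alpha> j =
     (if \<alpha> $ j = 0 then \<bar>g $ j\<bar> - lam else \<bar>g $ j + sgn (\<alpha> $ j) * lam\<bar>)"

lemma abs_s_vec:
  assumes "lam \<ge> 0"
  shows "\<bar>s_vec lam f \<alpha> $ j\<bar> = max 0 (index_score lam (gradient f \<alpha>) \<alpha> j)"
  using assms by (auto simp: s_vec_def soft_threshold_def index_score_def sgn_if)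

text \<open>The factors \<beta> in the first two blocks cancel against those in the query, leaving
  \<open>lam\<close> up to sign and \<open>c $ j\<close>; the last block supplies the rest of the
  gradient.\<close>

lemma inner_query:
  fixes A :: "real^'n^'d"
  assumes "l differentiable (at (A *v \<alpha>))" and "\<beta> \<noteq> 0"
  shows "tilde_plus \<beta> A c j \<bullet> query lam \<beta> l A \<alpha> = gradient (objective l A c) \<alpha> $ j + lam"
    and "tilde_minus \<beta> A c j \<bullet> query lam \<beta> l A \<alpha> = gradient (objective l A c) \<alpha> $ j - lam"
  using assms by (simp_all add: tilde_plus_def tilde_minus_def query_def gradient_objective)

lemma index_score_bound:
  fixes A :: "real^'n^'d"
  assumes "l differentiable (at (A *v \<alpha>))" and "\<beta> \<noteq> 0" and "has_index \<beta> A c \<alpha> p j"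
  shows "p \<bullet> query lam \<beta> l A \<alpha> \<le> index_score lam (gradient (objective l A c) \<alpha>) \<alpha> j"
  using assms(3) by (auto simp: has_index_def index_score_def inner_query[OF assms(1,2)])

lemma index_score_attained:
  fixes A :: "real^'n^'d"
  assumes "l differentiable (at (A *v \<alpha>))" and "\<beta> \<noteq> 0"
  obtains p where "has_index \<beta> A c \<alpha> p j"
    and "p \<bullet> query lam \<beta> l A \<alpha> = index_score lam (gradient (objective l A c) \<alpha>) \<alpha> j"
proof -
  let ?g = "gradient (objective l A c) \<alpha> $ j"
  let ?P = "tilde_plus \<beta> A c j" and ?M = "tilde_minus \<beta> A c j"
  \<comment> \<open>The sign of \<alpha> at \<open>j\<close> fixes the two available vectors. For a
    nonzero coordinate these are opposite, so the one with nonnegative product is taken; at zero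
    they are \<open>?M\<close> and \<open>- ?P\<close>, and the sign of \<open>?g\<close> selects
    the larger of \<open>?g - lam\<close> and \<open>- ?g - lam\<close>.\<close>
  define p where "p =
    (if \<alpha> $ j > 0 then (if ?g + lam \<ge> 0 then ?P else - ?P)
     else if \<alpha> $ j < 0 then (if ?g - lam \<ge> 0 then ?M else - ?M)
     else (if ?g \<ge> 0 then ?M else - ?P))"
  show ?thesis
    by (rule that[of p])
      (auto simp: p_def has_index_def index_score_def inner_query[OF assms])
qed

text \<open>Equality holds even where \<open>s_vec\<close> vanishes, since the score is not cut off
  at zero.\<close>

lemma returned_indices_S_MIPS:
  fixes A :: "real^'n^'d"
  assumes "l differentiable (at (A *v \<alpha>))" and "\<beta> \<noteq> 0"
  shows "returned_indices \<beta> A c \<alpha>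
           (S_MIPS (points \<beta> A c) (query lam \<beta> l A \<alpha>) (B_subset \<beta> A c \<alpha>)) =
         argmax_set (index_score lam (gradient (objective l A c) \<alpha>) \<alpha>) UNIV"
    (is "?L = argmax_set ?m UNIV")
proof -
  let ?q = "query lam \<beta> l A \<alpha>"
  have returned_iff: "j \<in> ?L \<longleftrightarrow>
      (\<exists>p. has_index \<beta> A c \<alpha> p j \<and> (\<forall>p' i. has_index \<beta> A c \<alpha> p' i \<longrightarrow> p' \<bullet> ?q \<le> p \<bullet> ?q))" for j
    using B_subset_points[of \<beta> A c \<alpha>]
    unfolding returned_indices_def S_MIPS_def argmax_set_linorder Ball_def Bex_def
      mem_Collect_eq subset_iff mem_B_subset_iff by blast
  show ?thesis
  proof (intro equalityI subsetI)
    fix j assume "j \<in> ?L"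
    then obtain p where p: "has_index \<beta> A c \<alpha> p j"
      and max: "\<And>p' i. has_index \<beta> A c \<alpha> p' i \<Longrightarrow> p' \<bullet> ?q \<le> p \<bullet> ?q"
      unfolding returned_iff by blast
    have "?m i \<le> ?m j" for i
    proof -
      obtain p' where "has_index \<beta> A c \<alpha> p' i" and "p' \<bullet> ?q = ?m i"
        using index_score_attained[OF assms] .
      then have "?m i \<le> p \<bullet> ?q"
        using max by metis
      \<comment> \<open>The vector \<open>p\<close> need not be known to attain the score of
        \<open>j\<close>; the upper bound suffices.\<close>
      also have "\<dots> \<le> ?m j"
        by (rule index_score_bound[OF assms p])
      finally show ?thesis .
    qed
    then show "j \<in> argmax_set ?m UNIV"
      by (simp add: argmax_set_linorder)
  next
    fix j assume "j \<in> argmax_set ?m UNIV"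
    then have max: "?m i \<le> ?m j" for i
      by (simp add: argmax_set_linorder)
    obtain p where p: "has_index \<beta> A c \<alpha> p j" and "p \<bullet> ?q = ?m j"
      using index_score_attained[OF assms] .
    then have "p' \<bullet> ?q \<le> p \<bullet> ?q" if "has_index \<beta> A c \<alpha> p' i" for p' i
      using index_score_bound[OF assms that] max by (metis order_trans)
    with p show "j \<in> ?L"
      unfolding returned_iff by blast
  qed
qed

theorem lemma3:
  fixes A :: "real^'n^'d" and c \<alpha> :: "real^'n" and l :: "real^'d \<Rightarrow> real"
    and lam \<beta> :: real
  assumes "convex_on UNIV l"
    and "\<And>x. l differentiable (at x)"
    and "lam \<ge> 0"
    and "\<beta> > 0"
  shows "let L = returned_indices \<beta> A c \<alpha>
                   (S_MIPS (points \<beta> A c) (query lam \<beta> l A \<alpha>) (B_subset \<beta> A c \<alpha>));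
             s = s_vec lam (objective l A c) \<alpha>;
             R = argmax_set (\<lambda>i. \<bar>s $ i\<bar>) UNIV
          in L \<noteq> {} \<and> L \<subseteq> R \<and> (s \<noteq> 0 \<longrightarrow> L = R)"
proof -
  let ?m = "index_score lam (gradient (objective l A c) \<alpha>) \<alpha>"
  let ?s = "s_vec lam (objective l A c) \<alpha>"
  have L: "returned_indices \<beta> A c \<alpha>
      (S_MIPS (points \<beta> A c) (query lam \<beta> l A \<alpha>) (B_subset \<beta> A c \<alpha>)) = argmax_set ?m UNIV"
    using assms by (intro returned_indices_S_MIPS) auto
  have s: "\<bar>?s $ i\<bar> = max 0 (?m i)" for i
    by (rule abs_s_vec[OF \<open>lam \<ge> 0\<close>])
  \<comment> \<open>A positive score is what makes truncation at zero create no new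
    maximizers.\<close>
  have "\<exists>i. 0 < ?m i" if "?s \<noteq> 0"
  proof -
    from that obtain i where "?s $ i \<noteq> 0"
      by (auto simp: vec_eq_iff)
    then have "0 < ?m i"
      using s[of i] by (auto simp: max_def split: if_splits)
    then show ?thesis ..
  qed
  then show ?thesis
    unfolding Let_def L s
    using argmax_set_finite_nonempty argmax_set_max_const[where f = ?m and S = UNIV and b = 0] by auto
qed

end
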